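(* Let $\alpha,\beta$ be positive integers with $\gcd(\alpha,\beta)=1$ and $\alpha\beta=2^{\nu}\mho$, where $\nu\in\{2,3\}$ and $\mho$ is an odd squarefree positive integer. Let $n\in\mathbb{N}$ and let $(a,b)\in\Omega_4$. Then $$N_{(a,b)}(n)=8\sigma\bigl(\tfrac na\bigr)-32\sigma\bigl(\tfrac n{4a}\bigr)+8\sigma\bigl(\tfrac nb\bigr)-32\sigma\bigl(\tfrac n{4b}\bigr)+64\,W_{(a,b)}(n)+1024\,W_{(a,b)}\bigl(\tfrac n4\bigr)-256\bigl(W_{(4a,b)}(n)+W_{(a,4b)}(n)\bigr).$$
   Context: $\mathbb{N}$ is the set of positive integers, $\mathbb{N}_0=\mathbb{N}\cup\{0\}$. $\sigma(n)=\sum_{0<d\mid n}d$ for $n\in\mathbb{N}$ and $\sigma(m)=0$ for $m\notin\mathbb{N}$. For positive integers $r,s$, $W_{(r,s)}(n)=\sum_{(l,m)\in\mathbb{N}_0^2,\ rl+sm=n}\sigma(l)\sigma(m)$, which is $0$ if there is no such representation of $n$ with $(l,m)\in\mathbb{N}^2$ (in particular if $n$ is not an integer). $N_{(a,b)}(n)$ is the number of $(x_1,\dots,x_8)\in\mathbb{Z}^8$ with $n=a(x_1^2+x_2^2+x_3^2+x_4^2)+b(x_5^2+x_6^2+x_7^2+x_8^2)$. Definition of $\Omega_4$ (for given $\alpha\beta=2^\nu\mho$): let $\Lambda=\alpha\beta/4=2^{\nu-2}\mho$ and $P_4=\{2^{\nu-2}\}\cup\{p: p\text{ is a prime divisor of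 }\mho\}$. For a subset $Q\subseteq P_4$ put $\mu(Q)=\prod_{p\in Q}p$, with $\mu(\emptyset)=1$. Then $\Omega_4$ is the set of pairs $(\mu(Q_1),\mu(Q_2))$ with $Q_1,Q_2\subseteq P_4$, $\gcd(\mu(Q_1),\mu(Q_2))=1$ and $\mu(Q_1)\mu(Q_2)=\Lambda$. *)

theory Defs
  imports Complex_Main "HOL-Computational_Algebra.Squarefree"
begin

text \<open>
  The divisor sum is evaluated at quotients such as \<open>n / (4 * a)\<close>, hence it is a function on
  the rationals that vanishes outside the positive integers. The values of \<open>sigma\<close> and \<open>W\<close> are
  taken in \<open>int\<close> because the formula for \<open>N\<close> contains subtractions.
\<close>

definition sigma :: "rat \<Rightarrow> int" where
  "sigma x = (if x \<in> \<nat> \<and> x > 0 then \<Sum>d | d dvd nat \<lfloor>x\<rfloor>. int d else 0)"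

text \<open>For \<open>r, s > 0\<close> the index set is finite; it is empty if \<open>x\<close> is not a natural number.\<close>

definition W :: "nat \<Rightarrow> nat \<Rightarrow> rat \<Rightarrow> int" where
  "W r s x = (\<Sum>(l, m) \<in> {(l :: nat, m :: nat). of_nat (r * l + s * m) = x}.
                sigma (of_nat l) * sigma (of_nat m))"

text \<open>For \<open>a, b > 0\<close> the set of representations is finite.\<close>

definition N :: "nat \<Rightarrow> nat \<Rightarrow> nat \<Rightarrow> nat" where
  "N a b n = card {(x1 :: int, x2 :: int, x3 :: int, x4 :: int,
                    x5 :: int, x6 :: int, x7 :: int, x8 :: int).
      int n = int a * (x1\<^sup>2 + x2\<^sup>2 + x3\<^sup>2 + x4\<^sup>2) + int b * (x5\<^sup>2 + x6\<^sup>2 + x7\<^sup>2 + x8\<^sup>2)}"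

text \<open>
  In \<open>P4\<close> and \<open>Omega4\<close> the numbers \<open>\<nu>\<close> and \<open>mho\<close> are those of the factorisation
  \<open>\<alpha> * \<beta> = 2 ^ \<nu> * mho\<close>. The exponent \<open>\<nu> - 2\<close> is meant for \<open>\<nu> \<ge> 2\<close>; for \<open>\<nu> = 2\<close> the set \<open>P4\<close>
  contains 1. The product \<open>2 ^ (\<nu> - 2) * mho\<close> is \<open>\<Lambda> = \<alpha> * \<beta> / 4\<close>.
\<close>

definition P4 :: "nat \<Rightarrow> nat \<Rightarrow> nat set" where
  "P4 \<nu> mho = {2 ^ (\<nu> - 2)} \<union> {p. prime p \<and> p dvd mho}"

definition \<mu> :: "nat set \<Rightarrow> nat" where
  "\<mu> Q = (\<Prod>p\<in>Q. p)"

definition Omega4 :: "nat \<Rightarrow> nat \<Rightarrow> (nat \<times> nat) set" where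
  "Omega4 \<nu> mho =
    {(\<mu> Q1, \<mu> Q2) | Q1 Q2. Q1 \<subseteq> P4 \<nu> mho \<and> Q2 \<subseteq> P4 \<nu> mho \<and>
       gcd (\<mu> Q1) (\<mu> Q2) = 1 \<and> \<mu> Q1 * \<mu> Q2 = 2 ^ (\<nu> - 2) * mho}"

end

theory Submission
  imports Defs
begin

text \<open>
  Let \<open>r(k)\<close> be the number of representations of \<open>k\<close> as a sum of four squares. Splitting a
  representation counted by \<open>N a b n\<close> into its two halves gives
  \<open>N a b n = (\<Sum>(l, m). r(l) * r(m))\<close> over all \<open>a * l + b * m = n\<close>. By Jacobi's theorem
  \<open>r(k) = 8 * \<sigma>(k) - 32 * \<sigma>(k/4)\<close> for \<open>k > 0\<close>, while \<open>r(0) = 1\<close>; multiplying out, the products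
  of two divisor sums give the values of \<open>W\<close>, and the terms with \<open>l = 0\<close> or \<open>m = 0\<close> give the
  isolated divisor sums (\<open>N_formula\<close>). So everything rests on \<open>Jacobi_four_squares\<close>.

  Jacobi's theorem is proved by comparing recurrences. In
  \<open>n = y\<^sup>2 + x1\<^sup>2 + x2\<^sup>2 + x3\<^sup>2 + x4\<^sup>2\<close> the five squares play the same role, so \<open>n - 5 * y\<^sup>2\<close> has
  average zero over all solutions, that is, \<open>(\<Sum>y. (n - 5 * y\<^sup>2) * r(n - y\<^sup>2)) = 0\<close>
  (\<open>four_square_recurrence\<close>). For \<open>n > 0\<close> the term \<open>y = 0\<close> is \<open>n * r(n)\<close>, hence the recurrence
  and \<open>r(0) = 1\<close> determine \<open>r\<close>. The divisor sum
  \<open>g(m) = (\<Sum>d * e = m. (-1) ^ ((d - 1) * (e - 1)) * d)\<close> equals \<open>\<sigma>(m) - 4 * \<sigma>(m/4)\<close>, because the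
  pairs with negative sign are the doubles of the factor pairs of \<open>m/4\<close>; so what is left is that
  \<open>8 * g\<close> satisfies the same recurrence up to the contribution of \<open>r(0)\<close>
  (\<open>signed_divisor_sum_recurrence\<close>). This is a statement about the triples with
  \<open>u\<^sup>2 + d * e = n\<close>, and it is the case \<open>F x y = (-1) ^ (x + y) * x * y\<^sup>2\<close> of an identity of
  Liouville, whose proof consists of three substitutions preserving the form \<open>u\<^sup>2 + d * e\<close>.
\<close>

section \<open>Liouville's identity\<close>

definition square_product_triples :: "int \<Rightarrow> (int \<times> int \<times> int) set" where
  "square_product_triples n = {(u, d, e). d > 0 \<and> e > 0 \<and> u\<^sup>2 + d * e = n}"

lemma factor_pairs_finite: "finite {(d :: int, e :: int). d > 0 \<and> e > 0 \<and> d * e = m}"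
proof (rule finite_subset)
  show "{(d :: int, e :: int). d > 0 \<and> e > 0 \<and> d * e = m} \<subseteq> {0..m} \<times> {0..m}"
    by (auto simp: mult_le_cancel_left1 mult_le_cancel_right1)
qed simp

lemma abs_le_square_int: "\<bar>u\<bar> \<le> (u :: int)\<^sup>2"
proof (cases "u = 0")
  case False
  then show ?thesis using self_le_power[of "\<bar>u\<bar>" 2] by simp
qed simp

lemma square_product_triples_eq_Sigma:
  "square_product_triples n =
     (SIGMA u:{-n..n}. {(d, e). d > 0 \<and> e > 0 \<and> d * e = n - u\<^sup>2})"
proof -
  have "-n \<le> u \<and> u \<le> n" if "d > 0" "e > 0" "u\<^sup>2 + d * e = n" for u d e :: int
  proof -
    have "0 < d * e" using that by simp
    then have "u\<^sup>2 \<le> n" using that by linarith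
    then show ?thesis using abs_le_square_int[of u] by linarith
  qed
  then show ?thesis
    unfolding square_product_triples_def by (auto simp: algebra_simps)
qed

lemma finite_square_product_triples: "finite (square_product_triples n)"
  unfolding square_product_triples_eq_Sigma using factor_pairs_finite by (intro finite_SigmaI) auto

lemma sum_triples_negate:
  fixes f :: "int \<Rightarrow> int \<Rightarrow> int \<Rightarrow> int"
  shows "(\<Sum>(u, d, e)\<in>square_product_triples n. f u d e) =
         (\<Sum>(u, d, e)\<in>square_product_triples n. f (-u) d e)"
  by (rule sum.reindex_bij_witness[where i = "\<lambda>(u, d, e). (-u, d, e)" and j = "\<lambda>(u, d, e). (-u, d, e)"])
     (auto simp: square_product_triples_def)

lemma sum_triples_swap:
  fixes f :: "int \<Rightarrow> int \<Rightarrow> int \<Rightarrow> int"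
  shows "(\<Sum>(u, d, e)\<in>square_product_triples n. f u d e) =
         (\<Sum>(u, d, e)\<in>square_product_triples n. f u e d)"
  by (rule sum.reindex_bij_witness[where i = "\<lambda>(u, d, e). (u, e, d)" and j = "\<lambda>(u, d, e). (u, e, d)"])
     (auto simp: square_product_triples_def mult.commute)

text \<open>
  The triples are divided according to the sign of \<open>2 * u + d - e\<close>. Where it is positive, the
  involution \<open>(u, d, e) \<mapsto> (e - u, 2 * u + d - e, e)\<close> changes the sign of \<open>e - 2 * u\<close> and keeps
  \<open>u + d\<close>, so the left-hand terms cancel. Where it is negative, \<open>(u, d, e) \<mapsto> (u + d, e - 2 * u - d, d)\<close>
  turns a left-hand term into a right-hand term of the positive part; exchanging
  \<open>d\<close> and \<open>e\<close> and negating \<open>u\<close> shows that the positive and negative parts of the right-hand sum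
  are equal, which explains the factor 2. On the diagonal
  \<open>2 * u + d = e\<close> nothing cancels, and its terms form the correction.
\<close>
lemma Liouville_identity:
  fixes F :: "int \<Rightarrow> int \<Rightarrow> int"
  assumes odd_fst: "\<And>x y. F (-x) y = - F x y" and even_snd: "\<And>x y. F x (-y) = F x y"
  shows "2 * (\<Sum>(u, d, e)\<in>square_product_triples n. F (e - 2 * u) (u + d)) =
      (\<Sum>(u, d, e)\<in>square_product_triples n. F (d + e) u) +
      (\<Sum>(u, d, e)\<in>{(u, d, e)\<in>square_product_triples n. 2 * u + d = e}.
         2 * F d (u + d) - F (2 * (u + d)) u)"
proof -
  let ?S = "square_product_triples n"
  let ?P = "{(u, d, e)\<in>?S. 2 * u + d > e}"
  let ?Z = "{(u, d, e)\<in>?S. 2 * u + d = e}"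
  let ?M = "{(u, d, e)\<in>?S. 2 * u + d < e}"
  have split: "(\<Sum>t\<in>?S. f t) = (\<Sum>t\<in>?P. f t) + (\<Sum>t\<in>?Z. f t) + (\<Sum>t\<in>?M. f t)"
    for f :: "int \<times> int \<times> int \<Rightarrow> int"
  proof -
    have S: "?S = ?P \<union> ?Z \<union> ?M" by auto
    have fin: "finite ?P" "finite ?Z" "finite ?M"
      by (rule finite_subset[OF _ finite_square_product_triples[of n]]; auto)+
    have "(\<Sum>t\<in>?P \<union> ?Z \<union> ?M. f t) = (\<Sum>t\<in>?P \<union> ?Z. f t) + (\<Sum>t\<in>?M. f t)"
      using fin by (intro sum.union_disjoint) auto
    also have "(\<Sum>t\<in>?P \<union> ?Z. f t) = (\<Sum>t\<in>?P. f t) + (\<Sum>t\<in>?Z. f t)"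
      using fin by (intro sum.union_disjoint) auto
    finally show ?thesis using S by simp
  qed
  have P: "(\<Sum>(u, d, e)\<in>?P. F (e - 2 * u) (u + d)) = 0"
  proof -
    have "(\<Sum>(u, d, e)\<in>?P. F (e - 2 * u) (u + d)) = (\<Sum>(u, d, e)\<in>?P. - F (e - 2 * u) (u + d))"
    proof (rule sum.reindex_bij_witness[where i = "\<lambda>(u, d, e). (e - u, 2 * u + d - e, e)"
            and j = "\<lambda>(u, d, e). (e - u, 2 * u + d - e, e)"])
      fix t assume "t \<in> ?P"
      then obtain u d e where t: "t = (u, d, e)" "(u, d, e) \<in> ?P" by auto
      show "(case (case t of (u, d, e) \<Rightarrow> (e - u, 2 * u + d - e, e)) of
          (u, d, e) \<Rightarrow> - F (e - 2 * u) (u + d)) = (case t of (u, d, e) \<Rightarrow> F (e - 2 * u) (u + d))"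
        using t odd_fst[of "e - 2 * u"] by (simp add: algebra_simps)
    qed (auto simp: square_product_triples_def power2_eq_square algebra_simps)
    then show ?thesis by (simp add: sum_negf case_prod_unfold)
  qed
  have M: "(\<Sum>(u, d, e)\<in>?M. F (e - 2 * u) (u + d)) = (\<Sum>(u, d, e)\<in>?P. F (d + e) u)"
    by (rule sum.reindex_bij_witness[where i = "\<lambda>(u, d, e). (u - e, e, d + 2 * u - e)"
            and j = "\<lambda>(u, d, e). (u + d, e - 2 * u - d, d)"])
       (auto simp: square_product_triples_def power2_eq_square algebra_simps)
  have PM: "(\<Sum>(u, d, e)\<in>?P. F (d + e) u) = (\<Sum>(u, d, e)\<in>?M. F (d + e) u)"
    by (rule sum.reindex_bij_witness[where i = "\<lambda>(u, d, e). (-u, e, d)" and j = "\<lambda>(u, d, e). (-u, e, d)"])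
       (auto simp: square_product_triples_def even_snd algebra_simps)
  have Z: "(\<Sum>(u, d, e)\<in>?Z. F (e - 2 * u) (u + d)) = (\<Sum>(u, d, e)\<in>?Z. F d (u + d))"
    by (rule sum.cong) auto
  have Z': "(\<Sum>(u, d, e)\<in>?Z. F (d + e) u) = (\<Sum>(u, d, e)\<in>?Z. F (2 * (u + d)) u)"
    by (rule sum.cong) (auto simp: algebra_simps)
  have D: "(\<Sum>(u, d, e)\<in>?Z. 2 * F d (u + d) - F (2 * (u + d)) u) =
      2 * (\<Sum>(u, d, e)\<in>?Z. F d (u + d)) - (\<Sum>(u, d, e)\<in>?Z. F (2 * (u + d)) u)"
    by (simp add: case_prod_unfold sum_subtractf sum_distrib_left)
  show ?thesis
    unfolding split[of "\<lambda>(u, d, e). F (e - 2 * u) (u + d)"] split[of "\<lambda>(u, d, e). F (d + e) u"]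
    unfolding P M PM Z Z' D by simp
qed

section \<open>The divisor side of the recurrence\<close>

definition parity_sign :: "int \<Rightarrow> int" where
  "parity_sign k = (if even k then 1 else -1)"

text \<open>
  For \<open>n = c\<^sup>2\<close>, these summands are the diagonal terms in the application of Liouville's identity
  below, up to the common factor \<open>2 * c * parity_sign c\<close>; then \<open>c = k + 1\<close>.
\<close>
lemma alternating_quadratic_sum:
  fixes c :: int
  shows "(\<Sum>d\<in>{1..2 * int k + 1}. parity_sign d * (3 * d * c - c\<^sup>2 - d\<^sup>2)) =
         - 3 * (int k + 1) * c + c\<^sup>2 + (int k + 1) * (2 * int k + 1)"
proof (induction k)
  case 0
  show ?case by (simp add: parity_sign_def)
next
  case (Suc k)
  have "{1..2 * int (Suc k) + 1} =
      insert (2 * int k + 3) (insert (2 * int k + 2) {1..2 * int k + 1})" by auto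
  then have "(\<Sum>d\<in>{1..2 * int (Suc k) + 1}. parity_sign d * (3 * d * c - c\<^sup>2 - d\<^sup>2)) =
      - (3 * (2 * int k + 3) * c - c\<^sup>2 - (2 * int k + 3)\<^sup>2) +
      ((3 * (2 * int k + 2) * c - c\<^sup>2 - (2 * int k + 2)\<^sup>2) +
      (\<Sum>d\<in>{1..2 * int k + 1}. parity_sign d * (3 * d * c - c\<^sup>2 - d\<^sup>2)))"
    by (simp add: parity_sign_def)
  then show ?case
    unfolding Suc by (simp add: algebra_simps power2_eq_square)
qed

text \<open>If \<open>e = 2 * u + d\<close> then \<open>u\<^sup>2 + d * e = (u + d)\<^sup>2\<close>, so the diagonal is empty unless \<open>n\<close> is a square.\<close>
lemma diagonal_triples:
  assumes "l > 0"
  shows "{(u, d, e)\<in>square_product_triples (l\<^sup>2). 2 * u + d = e} =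
         (\<lambda>d. (l - d, d, 2 * l - d)) ` {1..2 * l - 1}"
proof -
  have "u = l - d \<and> e = 2 * l - d \<and> 1 \<le> d \<and> d \<le> 2 * l - 1"
    if "d > 0" "e > 0" "u\<^sup>2 + d * e = l\<^sup>2" "2 * u + d = e" for u d e
  proof -
    have "(u + d)\<^sup>2 = l\<^sup>2" using that by (auto simp: power2_eq_square algebra_simps)
    moreover have "u + d > 0" using that by linarith
    ultimately have "u + d = l" using assms by (simp add: power2_eq_iff_nonneg)
    then show ?thesis using that by linarith
  qed
  then have "{(u, d, e)\<in>square_product_triples (l\<^sup>2). 2 * u + d = e} \<subseteq>
      (\<lambda>d. (l - d, d, 2 * l - d)) ` {1..2 * l - 1}"
    unfolding square_product_triples_def by (force simp: image_iff)
  moreover have "(\<lambda>d. (l - d, d, 2 * l - d)) ` {1..2 * l - 1} \<subseteq>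
      {(u, d, e)\<in>square_product_triples (l\<^sup>2). 2 * u + d = e}"
    by (auto simp: square_product_triples_def power2_eq_square algebra_simps)
  ultimately show ?thesis by (rule equalityI)
qed

lemma no_diagonal_triples:
  assumes "\<nexists>l. n = l\<^sup>2"
  shows "{(u, d, e)\<in>square_product_triples n. 2 * u + d = e} = {}"
proof -
  have "n = (u + d)\<^sup>2" if "u\<^sup>2 + d * (2 * u + d) = n" for u d :: int
    using that by (simp add: power2_eq_square algebra_simps)
  then show ?thesis using assms by (auto simp: square_product_triples_def)
qed

text \<open>
  Here \<open>F x y = parity_sign (x + y) * x * y\<^sup>2\<close> in Liouville's identity. On both sides the sign is
  that of \<open>u + d + e\<close>. Cubic monomials odd in \<open>u\<close> sum to zero, and \<open>d\<close> and \<open>e\<close> may be exchanged;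
  with \<open>A\<close> and \<open>C\<close> the signed sums of \<open>d\<^sup>2 * e\<close> and \<open>d * u\<^sup>2\<close>, the two sums over all triples become
  \<open>2 * A - 6 * C\<close> and \<open>2 * C\<close>, whose difference is twice the sum of interest, \<open>A - 4 * C\<close>.
\<close>
lemma signed_triple_sum:
  "2 * (\<Sum>(u, d, e)\<in>square_product_triples n. parity_sign (u + d + e) * d * (d * e - 4 * u\<^sup>2)) =
   (\<Sum>(u, d, e)\<in>{(u, d, e)\<in>square_product_triples n. 2 * u + d = e}.
      2 * (parity_sign (u + 2 * d) * d * (u + d)\<^sup>2) - parity_sign (3 * u + 2 * d) * (2 * (u + d)) * u\<^sup>2)"
  (is "2 * ?G = ?Z")
proof -
  let ?S = "square_product_triples n"
  define F :: "int \<Rightarrow> int \<Rightarrow> int" where "F x y = parity_sign (x + y) * x * y\<^sup>2" for x y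
  have L: "2 * (\<Sum>(u, d, e)\<in>?S. F (e - 2 * u) (u + d)) =
      (\<Sum>(u, d, e)\<in>?S. F (d + e) u) +
      (\<Sum>(u, d, e)\<in>{(u, d, e)\<in>?S. 2 * u + d = e}. 2 * F d (u + d) - F (2 * (u + d)) u)"
    by (rule Liouville_identity) (auto simp: F_def parity_sign_def)
  define A where "A = (\<Sum>(u, d, e)\<in>?S. parity_sign (u + d + e) * d * (d * e))"
  define C where "C = (\<Sum>(u, d, e)\<in>?S. parity_sign (u + d + e) * d * u\<^sup>2)"
  have C': "C = (\<Sum>(u, d, e)\<in>?S. parity_sign (u + d + e) * e * u\<^sup>2)"
    unfolding C_def by (subst sum_triples_swap) (simp add: add.commute add.left_commute)
  \<comment> \<open>Adding the sum reflected in \<open>u\<close> removes the monomials that are odd in \<open>u\<close>.\<close>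
  have "2 * (\<Sum>(u, d, e)\<in>?S. F (e - 2 * u) (u + d)) =
      (\<Sum>(u, d, e)\<in>?S. F (e - 2 * u) (u + d)) + (\<Sum>(u, d, e)\<in>?S. F (e + 2 * u) (d - u))"
    using sum_triples_negate[of "\<lambda>u d e. F (e - 2 * u) (u + d)" n] by simp
  also have "\<dots> = (\<Sum>(u, d, e)\<in>?S. F (e - 2 * u) (u + d) + F (e + 2 * u) (d - u))"
    by (simp add: case_prod_unfold sum.distrib)
  also have "\<dots> = (\<Sum>(u, d, e)\<in>?S. 2 * (parity_sign (u + d + e) * e * u\<^sup>2) +
      2 * (parity_sign (u + d + e) * d * (d * e)) - 8 * (parity_sign (u + d + e) * d * u\<^sup>2))"
  proof (rule sum.cong, simp, clarify)
    fix u d e :: int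
    have "parity_sign (e - 2 * u + (u + d)) = parity_sign (u + d + e)"
      "parity_sign (e + 2 * u + (d - u)) = parity_sign (u + d + e)"
      by (auto simp: parity_sign_def)
    then show "F (e - 2 * u) (u + d) + F (e + 2 * u) (d - u) =
      2 * (parity_sign (u + d + e) * e * u\<^sup>2) +
      2 * (parity_sign (u + d + e) * d * (d * e)) - 8 * (parity_sign (u + d + e) * d * u\<^sup>2)"
      unfolding F_def by (simp add: power2_eq_square algebra_simps)
  qed
  also have "\<dots> = 2 * C + 2 * A - 8 * C"
    using C' unfolding A_def C_def
    by (simp add: case_prod_unfold sum.distrib sum_subtractf sum_distrib_left[symmetric])
  finally have lhs: "2 * (\<Sum>(u, d, e)\<in>?S. F (e - 2 * u) (u + d)) = 2 * A - 6 * C" by simp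
  have "(\<Sum>(u, d, e)\<in>?S. F (d + e) u) =
      (\<Sum>(u, d, e)\<in>?S. parity_sign (u + d + e) * d * u\<^sup>2 + parity_sign (u + d + e) * e * u\<^sup>2)"
    by (rule sum.cong) (auto simp: F_def algebra_simps)
  also have "\<dots> = C + C"
    using C' unfolding C_def by (simp add: case_prod_unfold sum.distrib)
  finally have rhs: "(\<Sum>(u, d, e)\<in>?S. F (d + e) u) = 2 * C" by simp
  have G: "?G = A - 4 * C"
    unfolding A_def C_def
    by (simp add: case_prod_unfold sum_subtractf sum_distrib_left right_diff_distrib mult.left_commute)
  have "(\<Sum>(u, d, e)\<in>{(u, d, e)\<in>?S. 2 * u + d = e}. 2 * F d (u + d) - F (2 * (u + d)) u) = ?Z"
    by (rule sum.cong) (auto simp: F_def algebra_simps)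
  then show ?thesis using L lhs rhs G by linarith
qed

lemma signed_triple_sum_square:
  assumes "l > 0"
  shows "(\<Sum>(u, d, e)\<in>square_product_triples (l\<^sup>2). parity_sign (u + d + e) * d * (d * e - 4 * u\<^sup>2)) =
         - parity_sign l * l\<^sup>2"
proof -
  obtain k where k: "l = int k + 1"
    using assms by (metis add.commute zero_less_imp_eq_int of_nat_Suc gr0_implies_Suc)
  have "2 * (\<Sum>(u, d, e)\<in>square_product_triples (l\<^sup>2). parity_sign (u + d + e) * d * (d * e - 4 * u\<^sup>2)) =
      (\<Sum>d\<in>{1..2 * l - 1}. 2 * (parity_sign (l + d) * d * l\<^sup>2) -
         parity_sign (3 * l - d) * (2 * l) * (l - d)\<^sup>2)"
    unfolding signed_triple_sum diagonal_triples[OF assms]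
  proof (rule sum.reindex_cong[where l = "\<lambda>d. (l - d, d, 2 * l - d)"])
    fix d :: int
    have "l - d + 2 * d = l + d" "3 * (l - d) + 2 * d = 3 * l - d" by simp_all
    then show "(case (l - d, d, 2 * l - d) of (u, d, e) \<Rightarrow>
        2 * (parity_sign (u + 2 * d) * d * (u + d)\<^sup>2) -
        parity_sign (3 * u + 2 * d) * (2 * (u + d)) * u\<^sup>2) =
        2 * (parity_sign (l + d) * d * l\<^sup>2) - parity_sign (3 * l - d) * (2 * l) * (l - d)\<^sup>2"
      by (simp add: add.commute)
  qed (auto simp: inj_on_def)
  also have "\<dots> = (\<Sum>d\<in>{1..2 * l - 1}. 2 * l * parity_sign l * (parity_sign d * (3 * d * l - l\<^sup>2 - d\<^sup>2)))"
  proof (rule sum.cong[OF refl])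
    fix d :: int
    have "parity_sign (l + d) = parity_sign l * parity_sign d"
      "parity_sign (3 * l - d) = parity_sign l * parity_sign d"
      by (auto simp: parity_sign_def)
    then show "2 * (parity_sign (l + d) * d * l\<^sup>2) - parity_sign (3 * l - d) * (2 * l) * (l - d)\<^sup>2 =
        2 * l * parity_sign l * (parity_sign d * (3 * d * l - l\<^sup>2 - d\<^sup>2))"
      by (simp add: power2_eq_square algebra_simps)
  qed
  also have "\<dots> = 2 * l * parity_sign l * (- 3 * l * l + l\<^sup>2 + l * (2 * l - 1))"
  proof -
    have "2 * int k + 1 = 2 * l - 1" "int k + 1 = l" using k by simp_all
    with alternating_quadratic_sum[of l k]
    have "(\<Sum>d\<in>{1..2 * l - 1}. parity_sign d * (3 * d * l - l\<^sup>2 - d\<^sup>2)) =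
        - 3 * l * l + l\<^sup>2 + l * (2 * l - 1)" by (simp only:)
    then show ?thesis by (simp only: sum_distrib_left[symmetric])
  qed
  also have "\<dots> = 2 * (- parity_sign l * l\<^sup>2)"
    by (simp add: power2_eq_square algebra_simps)
  finally show ?thesis by simp
qed

text \<open>
  Since \<open>m = d * e\<close>, the sign is \<open>(-1) ^ ((d - 1) * (e - 1))\<close>, negative exactly when \<open>d\<close> and \<open>e\<close>
  are both even. Written with \<open>m + d + e\<close>, it becomes the sign of \<open>u + d + e\<close>, up to the
  constant sign of \<open>n\<close>, when \<open>m = n - u\<^sup>2\<close>.
\<close>
definition signed_divisor_sum :: "int \<Rightarrow> int" where
  "signed_divisor_sum m =
     (\<Sum>(d, e)\<in>{(d, e). d > 0 \<and> e > 0 \<and> d * e = m}. - parity_sign (m + d + e) * d)"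

lemma signed_divisor_sum_nonpos: "m \<le> 0 \<Longrightarrow> signed_divisor_sum m = 0"
proof -
  assume "m \<le> 0"
  have "d * e \<noteq> m" if "d > 0" "e > 0" for d e :: int
    using mult_pos_pos[OF that] \<open>m \<le> 0\<close> by linarith
  then have "{(d, e). d > 0 \<and> e > 0 \<and> d * e = m} = {}" by auto
  then show ?thesis unfolding signed_divisor_sum_def by (simp only: sum.empty)
qed

text \<open>
  Expanding the divisor sums gives a sum over all triples with \<open>y\<^sup>2 + d * e = n\<close>, where
  \<open>n - 5 * y\<^sup>2 = d * e - 4 * y\<^sup>2\<close>.
\<close>
lemma signed_divisor_sum_recurrence:
  assumes "n > 0"
  shows "(\<Sum>y\<in>{-n..n}. (n - 5 * y\<^sup>2) * signed_divisor_sum (n - y\<^sup>2)) =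
         (if \<exists>l. n = l\<^sup>2 then n else 0)"
proof -
  have "(\<Sum>y\<in>{-n..n}. (n - 5 * y\<^sup>2) * signed_divisor_sum (n - y\<^sup>2)) =
    (\<Sum>y\<in>{-n..n}. \<Sum>(d, e)\<in>{(d, e). d > 0 \<and> e > 0 \<and> d * e = n - y\<^sup>2}.
       - parity_sign n * (parity_sign (y + d + e) * d * (d * e - 4 * y\<^sup>2)))"
    unfolding signed_divisor_sum_def sum_distrib_left
  proof (intro sum.cong refl, clarify)
    fix y d e :: int
    assume de: "d * e = n - y\<^sup>2"
    have "parity_sign (n - y\<^sup>2 + d + e) = parity_sign n * parity_sign (y + d + e)"
      by (auto simp: parity_sign_def)
    then show "(n - 5 * y\<^sup>2) * (- parity_sign (n - y\<^sup>2 + d + e) * d) =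
        - parity_sign n * (parity_sign (y + d + e) * d * (d * e - 4 * y\<^sup>2))"
      unfolding de by (simp add: algebra_simps)
  qed
  also have "\<dots> = (\<Sum>(y, d, e)\<in>square_product_triples n.
       - parity_sign n * (parity_sign (y + d + e) * d * (d * e - 4 * y\<^sup>2)))"
    unfolding square_product_triples_eq_Sigma
    by (subst sum.Sigma) (auto intro: factor_pairs_finite)
  also have "\<dots> = - parity_sign n *
      (\<Sum>(y, d, e)\<in>square_product_triples n. parity_sign (y + d + e) * d * (d * e - 4 * y\<^sup>2))"
    by (simp add: case_prod_unfold sum_distrib_left)
  also have "\<dots> = (if \<exists>l. n = l\<^sup>2 then n else 0)"
  proof (cases "\<exists>l. n = l\<^sup>2")
    case True
    then obtain l where l: "n = \<bar>l\<bar>\<^sup>2" by auto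
    then have "\<bar>l\<bar> > 0" using assms by auto
    then show ?thesis
      using signed_triple_sum_square[of "\<bar>l\<bar>"] l by (auto simp: parity_sign_def)
  next
    case False
    then show ?thesis
      using signed_triple_sum[of n] no_diagonal_triples[of n] by simp
  qed
  finally show ?thesis .
qed

section \<open>Jacobi's four-square theorem\<close>

definition four_square_reps :: "int \<Rightarrow> (int \<times> int \<times> int \<times> int) set" where
  "four_square_reps m = {(x1, x2, x3, x4). m = x1\<^sup>2 + x2\<^sup>2 + x3\<^sup>2 + x4\<^sup>2}"

lemma four_square_reps_subset:
  "four_square_reps m \<subseteq> {-m..m} \<times> {-m..m} \<times> {-m..m} \<times> {-m..m}"
proof -
  have "-m \<le> x \<and> x \<le> m" if "x\<^sup>2 \<le> m" for x :: int
    using abs_le_square_int[of x] that by linarith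
  then show ?thesis
    unfolding four_square_reps_def by (auto simp: add_nonneg_nonneg)
qed

lemma finite_four_square_reps: "finite (four_square_reps m)"
  by (rule finite_subset[OF four_square_reps_subset]) simp

lemma card_four_square_reps_nonpos: 
  "card (four_square_reps 0) = 1" "m < 0 \<Longrightarrow> card (four_square_reps m) = 0"
proof -
  have "four_square_reps 0 = {(0, 0, 0, 0)}"
    using four_square_reps_subset[of 0] by (auto simp: four_square_reps_def)
  then show "card (four_square_reps 0) = 1" by simp
  show "card (four_square_reps m) = 0" if "m < 0"
    using four_square_reps_subset[of m] that by auto
qed

text \<open>
  The sum runs over the representations of \<open>n\<close> by five squares. Exchanging \<open>y\<close> with another
  variable shows that all five squares have the same total, so \<open>n\<close> and \<open>5 * y\<^sup>2\<close> do too.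
\<close>
lemma four_square_recurrence:
  "(\<Sum>y\<in>{-n..n}. (n - 5 * y\<^sup>2) * int (card (four_square_reps (n - y\<^sup>2)))) = 0"
proof -
  define Q where "Q = {(y :: int, x1 :: int, x2 :: int, x3 :: int, x4 :: int).
      n = y\<^sup>2 + x1\<^sup>2 + x2\<^sup>2 + x3\<^sup>2 + x4\<^sup>2}"
  have "-n \<le> y \<and> y \<le> n" if "n = y\<^sup>2 + x1\<^sup>2 + x2\<^sup>2 + x3\<^sup>2 + x4\<^sup>2" for y x1 x2 x3 x4 :: int
    using abs_le_square_int[of y] that zero_le_power2[of x1] zero_le_power2[of x2]
      zero_le_power2[of x3] zero_le_power2[of x4] by linarith
  then have Q: "Q = (SIGMA y:{-n..n}. four_square_reps (n - y\<^sup>2))"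
    unfolding Q_def four_square_reps_def by (auto simp: algebra_simps)
  have 1: "(\<Sum>(y, x1, x2, x3, x4)\<in>Q. x1\<^sup>2) = (\<Sum>(y, x1, x2, x3, x4)\<in>Q. y\<^sup>2)"
    by (rule sum.reindex_bij_witness[where i = "\<lambda>(y, x1, x2, x3, x4). (x1, y, x2, x3, x4)"
        and j = "\<lambda>(y, x1, x2, x3, x4). (x1, y, x2, x3, x4)"]) (auto simp: Q_def)
  have 2: "(\<Sum>(y, x1, x2, x3, x4)\<in>Q. x2\<^sup>2) = (\<Sum>(y, x1, x2, x3, x4)\<in>Q. y\<^sup>2)"
    by (rule sum.reindex_bij_witness[where i = "\<lambda>(y, x1, x2, x3, x4). (x2, x1, y, x3, x4)"
        and j = "\<lambda>(y, x1, x2, x3, x4). (x2, x1, y, x3, x4)"]) (auto simp: Q_def)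
  have 3: "(\<Sum>(y, x1, x2, x3, x4)\<in>Q. x3\<^sup>2) = (\<Sum>(y, x1, x2, x3, x4)\<in>Q. y\<^sup>2)"
    by (rule sum.reindex_bij_witness[where i = "\<lambda>(y, x1, x2, x3, x4). (x3, x1, x2, y, x4)"
        and j = "\<lambda>(y, x1, x2, x3, x4). (x3, x1, x2, y, x4)"]) (auto simp: Q_def)
  have 4: "(\<Sum>(y, x1, x2, x3, x4)\<in>Q. x4\<^sup>2) = (\<Sum>(y, x1, x2, x3, x4)\<in>Q. y\<^sup>2)"
    by (rule sum.reindex_bij_witness[where i = "\<lambda>(y, x1, x2, x3, x4). (x4, x1, x2, x3, y)"
        and j = "\<lambda>(y, x1, x2, x3, x4). (x4, x1, x2, x3, y)"]) (auto simp: Q_def)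
  have "(\<Sum>y\<in>{-n..n}. (n - 5 * y\<^sup>2) * int (card (four_square_reps (n - y\<^sup>2)))) =
      (\<Sum>y\<in>{-n..n}. \<Sum>x\<in>four_square_reps (n - y\<^sup>2). n - 5 * y\<^sup>2)"
    by (simp add: mult.commute)
  also have "\<dots> = (\<Sum>(y, x)\<in>Q. n - 5 * y\<^sup>2)"
    unfolding Q by (subst sum.Sigma) (auto intro: finite_four_square_reps)
  also have "\<dots> = (\<Sum>(y, x1, x2, x3, x4)\<in>Q. (x1\<^sup>2 + x2\<^sup>2 + x3\<^sup>2 + x4\<^sup>2) - 4 * y\<^sup>2)"
    by (rule sum.cong) (auto simp: Q_def)
  also have "\<dots> = (\<Sum>(y, x1, x2, x3, x4)\<in>Q. x1\<^sup>2) + (\<Sum>(y, x1, x2, x3, x4)\<in>Q. x2\<^sup>2) +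
      (\<Sum>(y, x1, x2, x3, x4)\<in>Q. x3\<^sup>2) + (\<Sum>(y, x1, x2, x3, x4)\<in>Q. x4\<^sup>2) -
      4 * (\<Sum>(y, x1, x2, x3, x4)\<in>Q. y\<^sup>2)"
    by (simp add: case_prod_unfold sum.distrib sum_subtractf sum_distrib_left)
  also have "\<dots> = 0"
    unfolding 1 2 3 4 by simp
  finally show ?thesis .
qed

text \<open>
  The part of the recurrence due to \<open>r(0) = 1\<close>: if \<open>n\<close> is a square, its two roots \<open>y\<close>
  contribute \<open>n - 5 * n\<close> each. It offsets 8 times \<open>signed_divisor_sum_recurrence\<close>.
\<close>
lemma sum_square_indicator:
  fixes n :: int
  assumes "n > 0"
  shows "(\<Sum>y\<in>{-n..n}. (n - 5 * y\<^sup>2) * (if n - y\<^sup>2 = 0 then 1 else 0)) =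
         (if \<exists>l. n = l\<^sup>2 then - 8 * n else 0)"
proof (cases "\<exists>l. n = l\<^sup>2")
  case True
  then obtain l where l: "n = l\<^sup>2" by blast
  then have l0: "l \<noteq> 0" using assms by auto
  have "(\<Sum>y\<in>{-n..n}. (n - 5 * y\<^sup>2) * (if n - y\<^sup>2 = 0 then 1 else 0)) =
      (\<Sum>y\<in>{l, -l}. (n - 5 * y\<^sup>2) * (if n - y\<^sup>2 = 0 then 1 else 0))"
    using abs_le_square_int[of l] by (intro sum.mono_neutral_right) (auto simp: l power2_eq_iff)
  also have "\<dots> = - 8 * n" using l0 by (simp add: l)
  finally show ?thesis using True by simp
next
  case False
  then have "n - y\<^sup>2 \<noteq> 0" for y by auto
  then show ?thesis using False by simp
qed

text \<open>
  The difference of the two sides satisfies the homogeneous recurrence; by induction only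
  the term \<open>y = 0\<close> survives, and its coefficient is \<open>n > 0\<close>.
\<close>
lemma card_four_square_reps:
  "int (card (four_square_reps (int m))) = (if m = 0 then 1 else 0) + 8 * signed_divisor_sum (int m)"
proof (induction m rule: less_induct)
  case (less m)
  define h :: "int \<Rightarrow> int" where "h k = (if k = 0 then 1 else 0) + 8 * signed_divisor_sum k" for k
  let ?r = "\<lambda>k. int (card (four_square_reps k))"
  show ?case
  proof (cases "m = 0")
    case True
    then show ?thesis by (simp add: card_four_square_reps_nonpos signed_divisor_sum_nonpos)
  next
    case False
    define n where "n = int m"
    have n: "n > 0" using False n_def by simp
    have "(\<Sum>y\<in>{-n..n}. (n - 5 * y\<^sup>2) * h (n - y\<^sup>2)) =
        (\<Sum>y\<in>{-n..n}. (n - 5 * y\<^sup>2) * (if n - y\<^sup>2 = 0 then 1 else 0)) +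
        8 * (\<Sum>y\<in>{-n..n}. (n - 5 * y\<^sup>2) * signed_divisor_sum (n - y\<^sup>2))"
      unfolding h_def sum_distrib_left sum.distrib[symmetric]
      by (rule sum.cong) (auto simp: algebra_simps)
    also have "\<dots> = 0"
      unfolding sum_square_indicator[OF n] signed_divisor_sum_recurrence[OF n] by simp
    finally have "(\<Sum>y\<in>{-n..n}. (n - 5 * y\<^sup>2) * (?r (n - y\<^sup>2) - h (n - y\<^sup>2))) = 0"
      using four_square_recurrence[of n] by (simp add: right_diff_distrib sum_subtractf)
    moreover have "(\<Sum>y\<in>{-n..n}. (n - 5 * y\<^sup>2) * (?r (n - y\<^sup>2) - h (n - y\<^sup>2))) =
        (\<Sum>y\<in>{0}. (n - 5 * y\<^sup>2) * (?r (n - y\<^sup>2) - h (n - y\<^sup>2)))"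
    proof (rule sum.mono_neutral_right)
      show "\<forall>y\<in>{-n..n} - {0}. (n - 5 * y\<^sup>2) * (?r (n - y\<^sup>2) - h (n - y\<^sup>2)) = 0"
      proof
        fix y assume "y \<in> {-n..n} - {0}"
        then have "y\<^sup>2 > 0" by simp
        show "(n - 5 * y\<^sup>2) * (?r (n - y\<^sup>2) - h (n - y\<^sup>2)) = 0"
        proof (cases "n - y\<^sup>2 < 0")
          case True
          then show ?thesis
            by (simp add: h_def card_four_square_reps_nonpos signed_divisor_sum_nonpos)
        next
          case False
          then obtain k where k: "n - y\<^sup>2 = int k" by (metis not_less nonneg_int_cases)
          then have "k < m" using \<open>y\<^sup>2 > 0\<close> n_def by linarith
          then show ?thesis using less.IH[of k] unfolding k h_def by simp
        qed
      qed
    qed (use n in auto)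
    ultimately have "n * (?r n - h n) = 0" by simp
    then show ?thesis using n unfolding h_def n_def by simp
  qed
qed

lemma sigma_of_nat: "sigma (of_nat k) = (if k = 0 then 0 else \<Sum>d | d dvd k. int d)"
  by (simp add: sigma_def)

lemma sigma_quotient:
  assumes "q > 0"
  shows "sigma (of_nat m / of_nat q) = (if q dvd m then sigma (of_nat (m div q)) else 0)"
proof (cases "q dvd m")
  case True
  then show ?thesis using assms by (auto simp: field_simps)
next
  case False
  have "(of_nat m / of_nat q :: rat) \<notin> \<nat>"
  proof
    assume "(of_nat m / of_nat q :: rat) \<in> \<nat>"
    then obtain k where "(of_nat m / of_nat q :: rat) = of_nat k" by (auto elim: Nats_cases)
    then have "(of_nat m :: rat) = of_nat (q * k)" using assms by (simp add: field_simps)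
    then have "m = q * k" using of_nat_eq_iff by blast
    then show False using False by simp
  qed
  then show ?thesis using False by (simp add: sigma_def)
qed

lemma sigma_eq_sum_factor_pairs:
  assumes "m > 0"
  shows "sigma (of_nat m) = (\<Sum>(d, e)\<in>{(d, e). d > 0 \<and> e > 0 \<and> d * e = int m}. d)"
proof -
  have "(\<Sum>d | d dvd m. int d) = (\<Sum>(d, e)\<in>{(d, e). d > 0 \<and> e > 0 \<and> d * e = int m}. d)"
  proof (rule sum.reindex_bij_witness[where i = "\<lambda>(d, e). nat d" and j = "\<lambda>d. (int d, int (m div d))"])
    fix t assume "t \<in> {(d, e). d > 0 \<and> e > 0 \<and> d * e = int m}"
    then obtain d e where t: "t = (d, e)" "d > 0" "e > 0" "d * e = int m" by auto
    then obtain d' e' where de: "d = int d'" "e = int e'" by (metis pos_int_cases)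
    then have "m = d' * e'" using t by (metis of_nat_eq_iff of_nat_mult)
    then show "(int (case t of (d, e) \<Rightarrow> nat d), int (m div (case t of (d, e) \<Rightarrow> nat d))) = t"
      and "(case t of (d, e) \<Rightarrow> nat d) \<in> {d. d dvd m}"
      using t de by auto
  next
    fix d assume "d \<in> {d. d dvd m}"
    then obtain e where "m = d * e" by auto
    then show "(int d, int (m div d)) \<in> {(d, e). d > 0 \<and> e > 0 \<and> d * e = int m}"
      using assms by auto
  qed auto
  then show ?thesis using assms by (simp add: sigma_of_nat)
qed

text \<open>
  Compared with \<open>\<sigma>(m)\<close>, each pair of even factors loses \<open>2 * d\<close>; halving both factors turns
  these pairs into the factor pairs of \<open>m/4\<close>, hence the coefficient 4.
\<close>
lemma signed_divisor_sum_eq_sigma: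
  "signed_divisor_sum (int m) = sigma (of_nat m) - 4 * sigma (of_nat m / 4)"
proof (cases "m = 0")
  case True
  then show ?thesis using sigma_of_nat[of 0] by (simp add: signed_divisor_sum_nonpos)
next
  case False
  let ?D = "\<lambda>k :: int. {(d, e). d > 0 \<and> e > 0 \<and> d * e = k}"
  let ?E = "{(d, e). d > 0 \<and> e > 0 \<and> d * e = int m \<and> even d \<and> even e}"
  have "signed_divisor_sum (int m) = (\<Sum>(d, e)\<in>?D (int m). d - (if even d \<and> even e then 2 * d else 0))"
    unfolding signed_divisor_sum_def
  proof (intro sum.cong refl, clarify)
    fix d e :: int
    assume "d * e = int m"
    then show "- parity_sign (int m + d + e) * d = d - (if even d \<and> even e then 2 * d else 0)"
      unfolding parity_sign_def \<open>d * e = int m\<close>[symmetric] by auto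
  qed
  also have "\<dots> = (\<Sum>(d, e)\<in>?D (int m). d) - (\<Sum>(d, e)\<in>?D (int m). if even d \<and> even e then 2 * d else 0)"
    by (simp add: case_prod_unfold sum_subtractf)
  also have "(\<Sum>(d, e)\<in>?D (int m). if even d \<and> even e then 2 * d else 0) = (\<Sum>(d, e)\<in>?E. 2 * d)"
    by (rule sum.mono_neutral_cong_right) (auto intro: factor_pairs_finite split: if_splits)
  also have "(\<Sum>(d, e)\<in>?E. 2 * d) = 4 * sigma (of_nat m / 4)"
  proof (cases "4 dvd m")
    case True
    then obtain k where k: "m = 4 * k" by auto
    then have k0: "k > 0" using False by simp
    have "(\<Sum>(d, e)\<in>?E. 2 * d) = (\<Sum>(d, e)\<in>?D (int k). 4 * d)"
      by (rule sum.reindex_bij_witness[where i = "\<lambda>(d, e). (2 * d, 2 * e)" and j = "\<lambda>(d, e). (d div 2, e div 2)"])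
         (auto simp: k elim!: evenE)
    also have "\<dots> = 4 * sigma (of_nat k)"
      unfolding sigma_eq_sum_factor_pairs[OF k0] by (simp add: case_prod_unfold sum_distrib_left)
    finally show ?thesis by (simp add: k)
  next
    case F: False
    have "\<not> (d * e = int m \<and> even d \<and> even e)" for d e
    proof
      assume *: "d * e = int m \<and> even d \<and> even e"
      then have "2 * 2 dvd d * e" by (intro mult_dvd_mono) auto
      then have "int 4 dvd int m" using * by simp
      then show False using F by (simp only: of_nat_dvd_iff)
    qed
    then have "?E = {}" by blast
    then have "(\<Sum>(d, e)\<in>?E. 2 * d) = 0" by (simp only: sum.empty)
    then show ?thesis using F sigma_quotient[of 4 m] by simp
  qed
  finally show ?thesis using sigma_eq_sum_factor_pairs[of m] False by simp
qed

theorem Jacobi_four_squares: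
  "int (card (four_square_reps (int m))) =
     (if m = 0 then 1 else 0) + 8 * sigma (of_nat m) - 32 * sigma (of_nat m / 4)"
  unfolding card_four_square_reps signed_divisor_sum_eq_sigma by simp

section \<open>Convolving the four-square counts\<close>

definition linear_reps :: "nat \<Rightarrow> nat \<Rightarrow> nat \<Rightarrow> (nat \<times> nat) set" where
  "linear_reps a b n = {(l, m). a * l + b * m = n}"

lemma finite_linear_reps:
  assumes "a > 0" "b > 0"
  shows "finite (linear_reps a b n)"
proof (rule finite_subset)
  have "l \<le> a * l + b * m" "m \<le> a * l + b * m" for l m
    using assms by (auto intro: trans_le_add1 trans_le_add2)
  then show "linear_reps a b n \<subseteq> {0..n} \<times> {0..n}"
    unfolding linear_reps_def by auto
qed simp

lemma N_eq_convolution: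
  assumes "a > 0" "b > 0"
  shows "int (N a b n) = (\<Sum>(l, m)\<in>linear_reps a b n.
           int (card (four_square_reps (int l))) * int (card (four_square_reps (int m))))"
proof -
  let ?T = "linear_reps a b n"
  let ?R = "\<lambda>(l, m). four_square_reps (int l) \<times> four_square_reps (int m)"
  let ?X = "{(x1 :: int, x2 :: int, x3 :: int, x4 :: int, x5 :: int, x6 :: int, x7 :: int, x8 :: int).
      int n = int a * (x1\<^sup>2 + x2\<^sup>2 + x3\<^sup>2 + x4\<^sup>2) + int b * (x5\<^sup>2 + x6\<^sup>2 + x7\<^sup>2 + x8\<^sup>2)}"
  let ?i = "\<lambda>(_, (x1, x2, x3, x4), (x5, x6, x7, x8)). (x1, x2, x3, x4, x5, x6, x7, x8)"
  let ?j = "\<lambda>(x1 :: int, x2 :: int, x3 :: int, x4 :: int, x5 :: int, x6 :: int, x7 :: int, x8 :: int).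
      ((nat (x1\<^sup>2 + x2\<^sup>2 + x3\<^sup>2 + x4\<^sup>2), nat (x5\<^sup>2 + x6\<^sup>2 + x7\<^sup>2 + x8\<^sup>2)),
        (x1, x2, x3, x4), (x5, x6, x7, x8))"
  have rep: "a * nat p + b * nat q = n \<longleftrightarrow> int n = int a * p + int b * q"
    if "p \<ge> 0" "q \<ge> 0" for p q
  proof -
    have "int (a * nat p + b * nat q) = int a * p + int b * q" using that by simp
    then show ?thesis by (metis of_nat_eq_iff)
  qed
  have "bij_betw ?j ?X (Sigma ?T ?R)"
  proof (rule bij_betw_byWitness[where f' = ?i])
    show "?j ` ?X \<subseteq> Sigma ?T ?R"
      by (auto simp: linear_reps_def four_square_reps_def rep)
    show "?i ` Sigma ?T ?R \<subseteq> ?X"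
      by (auto simp: linear_reps_def four_square_reps_def)
    show "\<forall>x\<in>Sigma ?T ?R. ?j (?i x) = x"
      by (auto simp: four_square_reps_def simp flip: of_nat_eq_iff)
  qed auto
  then have "N a b n = card (Sigma ?T ?R)"
    unfolding N_def by (rule bij_betw_same_card)
  also have "\<dots> = (\<Sum>t\<in>?T. card (?R t))"
    using finite_linear_reps[OF assms] finite_four_square_reps by (subst card_SigmaI) auto
  finally show ?thesis by (simp add: case_prod_unfold card_cartesian_product)
qed

lemma W_of_nat: "W r s (of_nat n) = (\<Sum>(l, m)\<in>linear_reps r s n. sigma (of_nat l) * sigma (of_nat m))"
  unfolding W_def linear_reps_def of_nat_eq_iff ..

lemma W_quotient:
  assumes "c > 0"
  shows "W r s (of_nat n / of_nat c) = W (c * r) (c * s) (of_nat n)"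
proof -
  have "(of_nat (r * l + s * m) = (of_nat n / of_nat c :: rat)) =
      (of_nat (c * r * l + c * s * m) = (of_nat n :: rat))" for l m
    using assms by (simp add: field_simps)
  then show ?thesis unfolding W_def by simp
qed

lemma sum_linear_reps_swap:
  "(\<Sum>(l, m)\<in>linear_reps a b n. f l m) = (\<Sum>(m, l)\<in>linear_reps b a n. f l m)"
  by (rule sum.reindex_bij_witness[where i = prod.swap and j = prod.swap])
     (auto simp: linear_reps_def add.commute)

text \<open>
  Only multiples \<open>l = p * l'\<close> and \<open>m = q * m'\<close> contribute, and they solve
  \<open>p * a * l' + q * b * m' = n\<close>.
\<close>
lemma convolution_of_dilated_sigmas:
  assumes "a > 0" "b > 0" "p > 0" "q > 0"
  shows "(\<Sum>(l, m)\<in>linear_reps a b n. sigma (of_nat l / of_nat p) * sigma (of_nat m / of_nat q)) =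
         W (p * a) (q * b) (of_nat n)"
proof -
  let ?T = "{(l, m)\<in>linear_reps a b n. p dvd l \<and> q dvd m}"
  have "(\<Sum>(l, m)\<in>linear_reps a b n. sigma (of_nat l / of_nat p) * sigma (of_nat m / of_nat q)) =
      (\<Sum>(l, m)\<in>?T. sigma (of_nat l / of_nat p) * sigma (of_nat m / of_nat q))"
    using assms by (intro sum.mono_neutral_right finite_linear_reps) (auto simp: sigma_quotient split: if_splits)
  also have "\<dots> = (\<Sum>(l, m)\<in>linear_reps (p * a) (q * b) n. sigma (of_nat l) * sigma (of_nat m))"
    using assms
    by (intro sum.reindex_bij_witness[where i = "\<lambda>(l, m). (p * l, q * m)" and j = "\<lambda>(l, m). (l div p, m div q)"])
       (auto simp: linear_reps_def sigma_quotient mult.commute mult.left_commute elim!: dvdE)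
  finally show ?thesis by (simp add: W_of_nat)
qed

text \<open>
  The contribution of \<open>r(0) = 1\<close> in one of the two factors of the convolution. When \<open>b\<close> does not
  divide \<open>n\<close> there is no solution with \<open>l = 0\<close>, and the divisor sum on the right vanishes
  because its argument is not an integer.
\<close>
lemma sum_over_zero_first_coordinate:
  assumes "a > 0" "b > 0" "q > 0"
  shows "(\<Sum>(l, m)\<in>linear_reps a b n. if l = 0 then sigma (of_nat m / of_nat q) else 0) =
         sigma (of_nat n / of_nat (q * b))"
proof -
  have "(\<Sum>(l, m)\<in>linear_reps a b n. if l = 0 then sigma (of_nat m / of_nat q) else 0) =
      (\<Sum>(l, m)\<in>{(l, m). l = (0 :: nat) \<and> b * m = n}. sigma (of_nat m / of_nat q))"
    using assms by (intro sum.mono_neutral_cong_right finite_linear_reps) (auto simp: linear_reps_def split: if_splits)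
  also have "\<dots> = sigma (of_nat n / of_nat (q * b))"
  proof (cases "b dvd n")
    case True
    then obtain k where k: "n = b * k" by auto
    then have "{(l, m). l = (0 :: nat) \<and> b * m = n} = {(0, k)}" using assms by auto
    then show ?thesis using assms by (simp add: k)
  next
    case False
    then have "\<not> q * b dvd n" by (metis dvd_mult_right)
    moreover have "{(l, m). l = (0 :: nat) \<and> b * m = n} = {}" using False by auto
    ultimately show ?thesis using assms sigma_quotient[of "q * b" n] by simp
  qed
  finally show ?thesis .
qed

theorem N_formula:
  assumes a: "a > 0" and b: "b > 0" and n: "n > 0"
  shows "int (N a b n) =
      8 * sigma (of_nat n / of_nat a) - 32 * sigma (of_nat n / (4 * of_nat a))
    + 8 * sigma (of_nat n / of_nat b) - 32 * sigma (of_nat n / (4 * of_nat b))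
    + 64 * W a b (of_nat n) + 1024 * W a b (of_nat n / 4)
    - 256 * (W (4 * a) b (of_nat n) + W a (4 * b) (of_nat n))"
proof -
  let ?T = "linear_reps a b n"
  let ?s = "\<lambda>q k :: nat. sigma (of_nat k / of_nat q)"
  have r: "int (card (four_square_reps (int m))) = (if m = 0 then 1 else 0) + 8 * ?s 1 m - 32 * ?s 4 m" for m
    using Jacobi_four_squares[of m] by simp
  have "int (N a b n) = (\<Sum>(l, m)\<in>?T.
      8 * (if l = 0 then ?s 1 m else 0) - 32 * (if l = 0 then ?s 4 m else 0) +
      8 * (if m = 0 then ?s 1 l else 0) - 32 * (if m = 0 then ?s 4 l else 0) +
      64 * (?s 1 l * ?s 1 m) + 1024 * (?s 4 l * ?s 4 m) -
      256 * (?s 4 l * ?s 1 m) - 256 * (?s 1 l * ?s 4 m))"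
    unfolding N_eq_convolution[OF a b] r
  proof (intro sum.cong refl, clarify)
    fix l m assume "(l, m) \<in> ?T"
    \<comment> \<open>The product of the two constant terms \<open>r(0) = 1\<close> would only occur for \<open>n = 0\<close>.\<close>
    then have "l \<noteq> 0 \<or> m \<noteq> 0" using n by (auto simp: linear_reps_def)
    then show "((if l = 0 then 1 else 0) + 8 * ?s 1 l - 32 * ?s 4 l) *
        ((if m = 0 then 1 else 0) + 8 * ?s 1 m - 32 * ?s 4 m) =
      8 * (if l = 0 then ?s 1 m else 0) - 32 * (if l = 0 then ?s 4 m else 0) +
      8 * (if m = 0 then ?s 1 l else 0) - 32 * (if m = 0 then ?s 4 l else 0) +
      64 * (?s 1 l * ?s 1 m) + 1024 * (?s 4 l * ?s 4 m) -
      256 * (?s 4 l * ?s 1 m) - 256 * (?s 1 l * ?s 4 m)"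
      by (cases "l = 0"; cases "m = 0") (simp_all add: algebra_simps)
  qed
  also have "\<dots> =
      8 * (\<Sum>(l, m)\<in>?T. if l = 0 then ?s 1 m else 0) - 32 * (\<Sum>(l, m)\<in>?T. if l = 0 then ?s 4 m else 0) +
      8 * (\<Sum>(l, m)\<in>?T. if m = 0 then ?s 1 l else 0) - 32 * (\<Sum>(l, m)\<in>?T. if m = 0 then ?s 4 l else 0) +
      64 * (\<Sum>(l, m)\<in>?T. ?s 1 l * ?s 1 m) + 1024 * (\<Sum>(l, m)\<in>?T. ?s 4 l * ?s 4 m) -
      256 * (\<Sum>(l, m)\<in>?T. ?s 4 l * ?s 1 m) - 256 * (\<Sum>(l, m)\<in>?T. ?s 1 l * ?s 4 m)"
    by (simp only: case_prod_unfold sum.distrib sum_subtractf sum_distrib_left)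
  also have "\<dots> =
      8 * ?s (1 * b) n - 32 * ?s (4 * b) n + 8 * ?s (1 * a) n - 32 * ?s (4 * a) n +
      64 * W (1 * a) (1 * b) (of_nat n) + 1024 * W (4 * a) (4 * b) (of_nat n) -
      256 * W (4 * a) (1 * b) (of_nat n) - 256 * W (1 * a) (4 * b) (of_nat n)"
    unfolding sum_linear_reps_swap[of "\<lambda>l m. if m = 0 then ?s 1 l else 0" a b n]
      sum_linear_reps_swap[of "\<lambda>l m. if m = 0 then ?s 4 l else 0" a b n]
    using a b by (simp only: sum_over_zero_first_coordinate convolution_of_dilated_sigmas zero_less_numeral zero_less_one)
  finally show ?thesis
    using W_quotient[of 4 a b n] by simp
qed

theorem theorem4p2:
  fixes \<alpha> \<beta> \<nu> mho n a b :: nat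
  assumes "\<alpha> > 0" and "\<beta> > 0" and "gcd \<alpha> \<beta> = 1"
    and "\<alpha> * \<beta> = 2 ^ \<nu> * mho" and "\<nu> \<in> {2, 3}"
    and "mho > 0" and "odd mho" and "squarefree mho"
    and "n > 0" and "(a, b) \<in> Omega4 \<nu> mho"
  shows "int (N a b n) =
      8 * sigma (of_nat n / of_nat a) - 32 * sigma (of_nat n / (4 * of_nat a))
    + 8 * sigma (of_nat n / of_nat b) - 32 * sigma (of_nat n / (4 * of_nat b))
    + 64 * W a b (of_nat n) + 1024 * W a b (of_nat n / 4)
    - 256 * (W (4 * a) b (of_nat n) + W a (4 * b) (of_nat n))"
proof -
  have "a * b = 2 ^ (\<nu> - 2) * mho"
    using assms(10) unfolding Omega4_def by auto
  then have "a * b > 0" using assms(6) by simp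
  then show ?thesis using assms(9) by (intro N_formula) auto
qed

end
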